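(* Let $n\geq3$ be odd and let $G_n$ be one of the two cyclic $(n,n)$-grids $A$, $B$ occurring in $Z_{n,n}=Z_{n,n}(a,b)$. Choose one of the two rulings of $G_n$, with supporting lines $\mathcal R=\{R_0,\ldots,R_{n-1}\}$. If the ruling is the one obtained by fixing the first index, let $L=L_+$ and $X^{*}=X_n\subset L_+$; if it is the opposite ruling (obtained by fixing the second index), let $L=L_-$ and $X^{*}=X'_n\subset L_-$. Then $X^{*}$ is the unique smallest set $X$ such that $G_n\cup X$ is collinearly complete with respect to $\mathcal R\cup\{L\}$. In particular, the completion consists of exactly $n$ points and is independent of the parameter $c$.
   Context: Work in $\mathbb P^3(\mathbb R)=\mathbb P(V)$, $V=\mathbb R^2\oplus\mathbb R^2$ with the standard Euclidean inner product. Let $\mathbb Z_n=\mathbb Z/n\mathbb Z$, $a,b\in\mathbb Z_n^\times$, $\alpha=2\pi a/n$, $\beta=2\pi b/n$, $u(\theta)=(\cos\theta,\sin\theta)$. The pair $(a,b)$ is assumed admissible: $-\cos(\alpha-\beta)/\cos(\alpha+\beta)$ is positive, finite and different from $1$; $c>0$ is defined by $c^2=-\cos(\alpha-\beta)/\cos(\alpha+\beta)$. For $(i,j)\in\mathbb Z_n^2$ put $A_{ij}=[u(i\alpha-j\beta):-c\,u(i\alpha+j\beta)]$ and $B_{ij}=[c\,u(i\alpha-j\beta):u(i\alpha+j\beta)]$, $A=\{A_{ij}\}$, $B=\{B_{ij}\}$, $Z_{n,n}(a,b)=A\sqcup B$. With coordinates $(u_1,u_2,v_1,v_2)$, $A$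 lies on the smooth quadric $Q_c\colon c^2(u_1^2+u_2^2)=v_1^2+v_2^2$ and $B$ on its Euclidean dual $u_1^2+u_2^2=c^2(v_1^2+v_2^2)$. Each grid consists of the $n^2$ intersection points of $n$ lines of one ruling of its quadric with $n$ lines of the other; the lines of the ruling obtained by fixing the first index are $R_i\ni A_{ij}$ for all $j$ (resp. $B_{ij}$ for all $j$), and those of the opposite ruling are obtained by fixing the second index $j$ and varying $i$. Spectral lines: $L_+=\mathbb P(\mathbb R^2\oplus0)$, $L_-=\mathbb P(0\oplus\mathbb R^2)$. Orbits: $X_n=\{P_r:r\in\mathbb Z_n\}$ with $P_r=[u(\tfrac{\pi}{2}+\tfrac{2\pi r}{n}):0]\in L_+$, and $X'_n=\{P'_s:s\in\mathbb Z_n\}$ with $P'_s=[0:u(\tfrac{\pi}{2}+\tfrac{2\pi s}{n})]\in L_-$. A finite point set $Z$ is collinearly complete with respect to a finite line arrangement $\mathcal L$ if every line meeting at least three members of $\mathcal L$ and containing a point of $Z$ has all its intersection points with the lines of $\mathcal L$ contained in $Z$. "Smallest" means contained in every other finite set with the stated property. *)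

theory Defs
  imports "HOL-Analysis.Analysis"
begin

section \<open>Projective points and lines\<close>

text \<open>
  A point of the projective space of a real vector space is a one-dimensional subspace
  \<open>[v] = span {v}\<close> with \<open>v \<noteq> 0\<close>, and \<open>proj W\<close> is the set of points of \<open>P(W)\<close> for a subspace
  \<open>W\<close>. Lines are sets of points, so incidence is membership and lines meet when they are not
  disjoint.
\<close>

definition pt :: "'a::real_vector \<Rightarrow> 'a set"
  where "pt v = span {v}"

definition proj :: "'a::real_vector set \<Rightarrow> 'a set set"
  where "proj W = {pt v | v. v \<in> W \<and> v \<noteq> 0}"

definition proj_line :: "'a::real_vector set set \<Rightarrow> bool"
  where "proj_line l \<longleftrightarrow> (\<exists>W. subspace W \<and> dim W = 2 \<and> l = proj W)"

definition proj_join :: "'a::real_vector set set \<Rightarrow> 'a set set"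
  where "proj_join S = proj (span (\<Union>S))"


section \<open>Collinear completeness\<close>

definition collinearly_complete :: "'a::real_vector set set \<Rightarrow> 'a set set set \<Rightarrow> bool"
  where "collinearly_complete Z \<L> \<longleftrightarrow>
    finite Z \<and> Z \<subseteq> proj UNIV \<and> finite \<L> \<and> (\<forall>m\<in>\<L>. proj_line m) \<and>
    (\<forall>l. proj_line l \<and> card {m \<in> \<L>. l \<inter> m \<noteq> {}} \<ge> 3 \<and> l \<inter> Z \<noteq> {}
        \<longrightarrow> (\<forall>m\<in>\<L>. l \<inter> m \<subseteq> Z))"

definition completes :: "'a::real_vector set set \<Rightarrow> 'a set set set \<Rightarrow> 'a set set \<Rightarrow> bool"
  where "completes G \<L> X \<longleftrightarrow>
    finite X \<and> X \<subseteq> proj UNIV \<and> collinearly_complete (G \<union> X) \<L>"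

definition smallest_completion :: "'a::real_vector set set \<Rightarrow> 'a set set set \<Rightarrow> 'a set set \<Rightarrow> bool"
  where "smallest_completion G \<L> X \<longleftrightarrow>
    completes G \<L> X \<and> (\<forall>Y. completes G \<L> Y \<longrightarrow> X \<subseteq> Y)"


section \<open>The grids\<close>

type_synonym vec4 = "(real^2) \<times> (real^2)"

definition u :: "real \<Rightarrow> real^2"
  where "u \<theta> = vector [cos \<theta>, sin \<theta>]"

text \<open>
  Residue classes modulo \<open>n\<close> are given by integer representatives, so \<open>angle n a\<close> is only
  meaningful modulo \<open>2 * pi\<close>; everything below depends on it through \<open>cos\<close> and \<open>sin\<close> of integer
  combinations. The indices \<open>i\<close>, \<open>j\<close> run over the representatives \<open>0, \<dots>, n - 1\<close>.
\<close>

definition angle :: "nat \<Rightarrow> int \<Rightarrow> real"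
  where "angle n a = 2 * pi * of_int a / of_nat n"

definition c_squared :: "nat \<Rightarrow> int \<Rightarrow> int \<Rightarrow> real"
  where "c_squared n a b = - cos (angle n a - angle n b) / cos (angle n a + angle n b)"

definition admissible :: "nat \<Rightarrow> int \<Rightarrow> int \<Rightarrow> bool"
  where "admissible n a b \<longleftrightarrow>
    cos (angle n a + angle n b) \<noteq> 0 \<and> c_squared n a b > 0 \<and> c_squared n a b \<noteq> 1"

datatype grid_kind = Grid_A | Grid_B

fun grid_pt :: "grid_kind \<Rightarrow> nat \<Rightarrow> int \<Rightarrow> int \<Rightarrow> real \<Rightarrow> nat \<Rightarrow> nat \<Rightarrow> vec4 set"
  where
    "grid_pt Grid_A n a b c i j =
       pt (u (real i * angle n a - real j * angle n b),
           - c *\<^sub>R u (real i * angle n a + real j * angle n b))"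
  | "grid_pt Grid_B n a b c i j =
       pt (c *\<^sub>R u (real i * angle n a - real j * angle n b),
           u (real i * angle n a + real j * angle n b))"

definition grid :: "grid_kind \<Rightarrow> nat \<Rightarrow> int \<Rightarrow> int \<Rightarrow> real \<Rightarrow> vec4 set set"
  where "grid g n a b c = {grid_pt g n a b c i j | i j. i < n \<and> j < n}"

text \<open>The constructors name the index that is constant along each line of the ruling.\<close>

datatype ruling = Fix_First | Fix_Second

fun ruling_line :: "ruling \<Rightarrow> grid_kind \<Rightarrow> nat \<Rightarrow> int \<Rightarrow> int \<Rightarrow> real \<Rightarrow> nat \<Rightarrow> vec4 set set"
  where
    "ruling_line Fix_First g n a b c i = proj_join {grid_pt g n a b c i j | j. j < n}"
  | "ruling_line Fix_Second g n a b c j = proj_join {grid_pt g n a b c i j | i. i < n}"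

definition ruling_lines :: "ruling \<Rightarrow> grid_kind \<Rightarrow> nat \<Rightarrow> int \<Rightarrow> int \<Rightarrow> real \<Rightarrow> vec4 set set set"
  where "ruling_lines \<rho> g n a b c = {ruling_line \<rho> g n a b c k | k. k < n}"


section \<open>Spectral lines and orbits\<close>

definition L_plus :: "vec4 set set"
  where "L_plus = proj (UNIV \<times> {0})"

definition L_minus :: "vec4 set set"
  where "L_minus = proj ({0} \<times> UNIV)"

definition X_plus :: "nat \<Rightarrow> vec4 set set"
  where "X_plus n = {pt (u (pi / 2 + 2 * pi * real r / real n), 0) | r. r < n}"

definition X_minus :: "nat \<Rightarrow> vec4 set set"
  where "X_minus n = {pt (0, u (pi / 2 + 2 * pi * real s / real n)) | s. s < n}"

fun spectral_line :: "ruling \<Rightarrow> vec4 set set"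
  where
    "spectral_line Fix_First = L_plus"
  | "spectral_line Fix_Second = L_minus"

fun X_star :: "ruling \<Rightarrow> nat \<Rightarrow> vec4 set set"
  where
    "X_star Fix_First n = X_plus n"
  | "X_star Fix_Second n = X_minus n"

end

theory Submission
  imports Defs "HOL-Number_Theory.Cong"
begin

text \<open>
  Identify \<open>V\<close> with \<open>\<complex>\<^sup>2\<close>. Up to a linear change of coordinates, the grid consists of the points
  \<open>[\<omega> cnj z : \<omega> z]\<close> with \<open>\<omega>\<close>, \<open>z\<close> among the \<open>n\<close>-th roots of unity, its lines are obtained by letting
  \<open>z\<close> run through \<open>\<complex>\<close>, the spectral line is \<open>[x : 0]\<close>, and the orbit is \<open>[\<i>\<omega> : 0]\<close>. As \<open>n\<close> is odd, a
  point \<open>[\<omega> cnj z : \<omega> z]\<close> of a grid line is a grid point iff \<open>z ^ n\<close> is real, and \<open>[x : 0]\<close> is in the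
  orbit iff \<open>(\<i>x) ^ n\<close> is real. A line joining points \<open>z\<^sub>1\<close>, \<open>z\<^sub>2\<close> of two grid lines either lies in the
  opposite ruling of the quadric \<open>\<bar>x\<bar> = \<bar>y\<bar>\<close>, and then misses the spectral line and has the same
  parameter \<open>z\<close> everywhere up to real factors, or it meets no third grid line. In the latter
  case it meets the spectral line iff \<open>\<omega>\<^sub>1 z\<^sub>1\<close> and \<open>\<omega>\<^sub>2 z\<^sub>2\<close> agree up to a real factor, and then at
  \<open>x = \<i> \<omega>\<^sub>2 cnj z\<^sub>1\<close> up to a real factor. In both cases one of the points in question belongs to
  the completion iff all do.
\<close>

section \<open>Projective points, lines and subspaces\<close>

lemma pt_eqE:
  assumes "pt v = pt w" "v \<noteq> 0"
  obtains t where "t \<noteq> 0" "w = t *\<^sub>R v"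
proof -
  have "w \<in> span {v}"
    using assms(1) span_base[of w "{w}"] by (auto simp: pt_def)
  then obtain t where t: "w = t *\<^sub>R v"
    by (auto simp: span_singleton)
  moreover have "t \<noteq> 0"
    using assms t span_base[of v "{v}"] by (auto simp: pt_def)
  ultimately show thesis by (rule that[rotated])
qed

lemma pt_scaleR: "t \<noteq> 0 \<Longrightarrow> pt (t *\<^sub>R v) = pt v"
  unfolding pt_def by (rule span_image_scale[of "{v}" "\<lambda>_. t", simplified])

lemma pt_in_proj:
  assumes "subspace W" "v \<noteq> 0"
  shows "pt v \<in> proj W \<longleftrightarrow> v \<in> W"
proof
  assume "pt v \<in> proj W"
  then obtain w where w: "w \<in> W" "w \<noteq> 0" "pt w = pt v"
    by (auto simp: proj_def)
  then show "v \<in> W"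
    using assms(1) by (metis pt_eqE subspace_scale)
qed (use assms in \<open>auto simp: proj_def\<close>)

lemma proj_meets_iff:
  assumes "subspace W"
  shows "proj W \<inter> proj V \<noteq> {} \<longleftrightarrow> (\<exists>v\<in>V. v \<noteq> 0 \<and> v \<in> W)"
proof
  assume "proj W \<inter> proj V \<noteq> {}"
  then obtain v where "v \<in> V" "v \<noteq> 0" "pt v \<in> proj W"
    by (auto simp: proj_def)
  then show "\<exists>v\<in>V. v \<noteq> 0 \<and> v \<in> W"
    using pt_in_proj[OF assms] by auto
next
  assume "\<exists>v\<in>V. v \<noteq> 0 \<and> v \<in> W"
  then show "proj W \<inter> proj V \<noteq> {}"
    by (auto simp: proj_def)
qed

lemma proj_line_range:
  fixes f :: "complex \<Rightarrow> 'b::euclidean_space"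
  assumes "linear f" "inj f"
  shows "proj_line (proj (range f))"
proof -
  have "dim (range f) = 2"
    using dim_image_eq[OF assms(1), of UNIV] assms(2) by simp
  then show ?thesis
    unfolding proj_line_def using linear_subspace_image[OF assms(1) subspace_UNIV] by blast
qed

lemma proj_join_pt_image: "proj_join (pt ` S) = proj (span S)"
proof -
  have "span (\<Union> (pt ` S)) = span S"
  proof (rule span_eq[THEN iffD2], intro conjI)
    show "\<Union> (pt ` S) \<subseteq> span S"
      unfolding pt_def by (auto intro: subsetD[OF span_mono, rotated])
    show "S \<subseteq> span (\<Union> (pt ` S))"
      unfolding pt_def by (auto intro!: span_base intro: bexI span_base)
  qed
  then show ?thesis by (simp add: proj_join_def)
qed

text \<open>Supplies real coordinates on a plane once two independent vectors of it are known; the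
  vectors will come from two skew grid lines.\<close>

lemma plane_decomposition:
  fixes W :: "'b::euclidean_space set"
  assumes "subspace W" "dim W = 2" "v \<in> W" "w \<in> W" "x \<in> W" "v \<noteq> 0" "w \<notin> span {v}"
  obtains s t where "x = s *\<^sub>R v + t *\<^sub>R w"
proof -
  have ind: "independent {v, w}"
    using assms(6,7) independent_insertI[of w "{v}"] by (simp add: insert_commute)
  have "v \<noteq> w" using assms(7) span_base[of v "{v}"] by auto
  then have "W \<subseteq> span {v, w}"
    using card_ge_dim_independent[OF _ ind, of W] assms by auto
  then have "x \<in> span {v, w}" using assms(5) by auto
  then obtain s t where "x - s *\<^sub>R v = t *\<^sub>R w"
    by (auto simp: span_insert span_singleton)
  then show thesis using that[of s t] by (simp add: algebra_simps)
qed


section \<open>Odd roots of unity and their real multiples\<close>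

definition unity_roots :: "nat \<Rightarrow> complex set"
  where "unity_roots n = {z. z ^ n = 1}"

text \<open>For odd \<open>n\<close> these are the nonzero real multiples of the \<open>n\<close>-th roots of unity.\<close>

definition real_power :: "nat \<Rightarrow> complex set"
  where "real_power n = {z. z \<noteq> 0 \<and> z ^ n \<in> \<real>}"

lemma unity_roots_mult: "z \<in> unity_roots n \<Longrightarrow> w \<in> unity_roots n \<Longrightarrow> z * w \<in> unity_roots n"
  by (simp add: unity_roots_def power_mult_distrib)

lemma unity_roots_cnj: "z \<in> unity_roots n \<Longrightarrow> cnj z \<in> unity_roots n"
  by (simp add: unity_roots_def flip: complex_cnj_power)

lemma one_unity_root [simp]: "1 \<in> unity_roots n"
  by (simp add: unity_roots_def)

lemma unity_roots_mult_cnj: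
  assumes "n > 0" "z \<in> unity_roots n"
  shows "z * cnj z = 1"
proof -
  have "cmod z ^ n = 1" using assms(2) by (simp add: unity_roots_def flip: norm_power)
  then have "cmod z = 1"
    using assms(1) power_eq_imp_eq_base[of "cmod z" n 1] by simp
  then show ?thesis by (simp add: complex_norm_square[symmetric])
qed

lemma unity_roots_subset_real_power: "z \<in> unity_roots n \<Longrightarrow> n > 0 \<Longrightarrow> z \<in> real_power n"
  by (auto simp: unity_roots_def real_power_def zero_power)

lemma real_power_mult_iff:
  assumes "z \<in> real_power n"
  shows "z * w \<in> real_power n \<longleftrightarrow> w \<in> real_power n"
proof -
  have z: "z \<noteq> 0" "z ^ n \<in> \<real>" using assms by (auto simp: real_power_def)
  then have "w ^ n = (z * w) ^ n / z ^ n" by (simp add: power_mult_distrib)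
  then have "(z * w) ^ n \<in> \<real> \<longleftrightarrow> w ^ n \<in> \<real>"
    using Reals_divide[OF _ z(2)] Reals_mult[OF z(2)] unfolding power_mult_distrib by metis
  then show ?thesis using z(1) by (simp add: real_power_def)
qed

lemma real_power_scaleR_iff: "t \<noteq> 0 \<Longrightarrow> t *\<^sub>R w \<in> real_power n \<longleftrightarrow> w \<in> real_power n"
  unfolding scaleR_conv_of_real by (rule real_power_mult_iff) (simp add: real_power_def flip: of_real_power)

lemma real_power_cnj_iff: "cnj w \<in> real_power n \<longleftrightarrow> w \<in> real_power n"
  by (auto simp: real_power_def Reals_cnj_iff simp flip: complex_cnj_power)

text \<open>The vanishing imaginary part makes \<open>z\<close> and \<open>w\<close> proportional
  over the reals: |w|^2 z = Re (z cnj w) w, and the real factors cancel.\<close>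

lemma real_power_parallel:
  assumes "Im (z * cnj w) = 0" "z \<noteq> 0" "w \<noteq> 0"
  shows "z \<in> real_power n \<longleftrightarrow> w \<in> real_power n"
proof -
  have "z * cnj w = of_real (Re (z * cnj w))" using assms(1) by (simp add: complex_eq_iff)
  then have "z * (cnj w * w) = of_real (Re (z * cnj w)) * w" by (metis mult.assoc)
  moreover have "cnj w * w = of_real ((norm w)\<^sup>2)" by (simp only: complex_norm_square mult.commute)
  ultimately have eq: "(norm w)\<^sup>2 *\<^sub>R z = Re (z * cnj w) *\<^sub>R w"
    unfolding scaleR_conv_of_real by (simp only: mult.commute)
  moreover have "Re (z * cnj w) \<noteq> 0" "(norm w)\<^sup>2 \<noteq> 0" using eq assms by auto
  ultimately show ?thesis by (metis real_power_scaleR_iff)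
qed

text \<open>The quotient \<open>z * cnj w\<close> is a real n-th root of unity, and for odd n the
  only such root is 1. This is where -1 is excluded.\<close>

lemma unity_roots_eq_if_Im_eq_0:
  assumes "odd n" "z \<in> unity_roots n" "w \<in> unity_roots n" "Im (z * cnj w) = 0"
  shows "z = w"
proof -
  have n: "n > 0" using assms(1) by (simp add: odd_pos)
  obtain r where r: "z * cnj w = of_real r"
    using assms(4) that[of "Re (z * cnj w)"] by (simp add: complex_eq_iff)
  have "(z * cnj w) ^ n = 1"
    using unity_roots_mult[OF assms(2) unity_roots_cnj[OF assms(3)]] by (simp add: unity_roots_def)
  then have "r ^ n = 1" unfolding r by (simp flip: of_real_power)
  then have "r = 1"
    using odd_real_root_power_cancel[OF assms(1), of r] n by simp
  then have "z * cnj w * w = w" using r by simp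
  then have "z * (w * cnj w) = w" by (simp only: ac_simps)
  then show ?thesis using unity_roots_mult_cnj[OF n assms(3)] by simp
qed

text \<open>For odd n the real number \<open>z ^ n\<close>, of either sign, has a real n-th root;
  dividing \<open>z\<close> by it leaves a root of unity.\<close>

lemma real_power_decomposition:
  assumes "odd n" "z \<in> real_power n"
  obtains t \<omega> where "t \<noteq> 0" "\<omega> \<in> unity_roots n" "z = t *\<^sub>R \<omega>"
proof -
  obtain r where r: "z ^ n = of_real r" and z: "z \<noteq> 0"
    using assms(2) by (auto simp: real_power_def Reals_def)
  then have "r \<noteq> 0" using z by auto
  let ?t = "root n r"
  have n: "n > 0" using assms(1) by (simp add: odd_pos)
  have t: "?t \<noteq> 0" "?t ^ n = r" using \<open>r \<noteq> 0\<close> n assms(1) by (simp_all add: odd_real_root_pow)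
  have "(z / of_real ?t) ^ n = 1"
    using r t \<open>r \<noteq> 0\<close> by (simp add: power_divide flip: of_real_power)
  then show thesis
    using that[of ?t "z / of_real ?t"] t by (simp add: unity_roots_def scaleR_conv_of_real)
qed

lemma unity_roots_nontrivial:
  assumes "n \<ge> 3"
  obtains \<omega> where "\<omega> \<in> unity_roots n" "\<omega> \<noteq> 1"
proof -
  have "card (unity_roots n) = n"
    unfolding unity_roots_def using assms by (intro card_roots_unity_eq) auto
  then have "\<not> unity_roots n \<subseteq> {1}"
    using assms card_mono[of "{1::complex}" "unity_roots n"] by auto
  then show thesis using that by auto
qed

text \<open>A root of unity other than 1 is nonreal for odd n, so together with 1 it is a real basis
  of the complex numbers.\<close>

lemma span_unity_roots:
  assumes "n \<ge> 3" "odd n"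
  shows "span (unity_roots n) = UNIV"
proof -
  obtain \<omega> where \<omega>: "\<omega> \<in> unity_roots n" "\<omega> \<noteq> 1" using unity_roots_nontrivial[OF assms(1)] .
  have im: "Im \<omega> \<noteq> 0" using unity_roots_eq_if_Im_eq_0[OF assms(2) \<omega>(1) one_unity_root] \<omega>(2) by auto
  have "z \<in> span (unity_roots n)" for z
  proof -
    have "z = (Re z - Im z / Im \<omega> * Re \<omega>) *\<^sub>R 1 + (Im z / Im \<omega>) *\<^sub>R \<omega>"
      using im by (simp add: complex_eq_iff)
    also have "\<dots> \<in> span (unity_roots n)"
      by (intro span_add span_scale span_base one_unity_root \<omega>)
    finally show ?thesis .
  qed
  then show ?thesis by auto
qed

text \<open>Multiplication by the unit \<open>a\<close> permutes the residues modulo n, so the index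
  set of the grid sweeps out all n-th roots of unity.\<close>

lemma cis_angle_multiples:
  assumes "n > 0" "coprime a (int n)"
  shows "(\<lambda>k. cis (real k * angle n a)) ` {..<n} = unity_roots n"
proof (intro equalityI subsetI)
  fix z assume "z \<in> (\<lambda>k. cis (real k * angle n a)) ` {..<n}"
  then obtain k where z: "z = cis (real k * angle n a)" by auto
  have "real n * (real k * angle n a) = 2 * pi * of_int (int k * a)"
    using assms(1) by (simp add: angle_def)
  then have "z ^ n = 1"
    unfolding z Complex.DeMoivre using cis_multiple_2pi[OF Ints_of_int[of "int k * a"]] by (simp only:)
  then show "z \<in> unity_roots n" by (simp add: unity_roots_def)
next
  fix z assume "z \<in> unity_roots n"
  then obtain r where r: "r < n" "z = cis (2 * pi * real r / real n)"
    using Complex.bij_betw_roots_unity[OF assms(1)] by (auto simp: unity_roots_def bij_betw_def)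
  \<comment> \<open>With \<open>x\<close> the inverse of \<open>a\<close>, the index
    \<open>k\<close> is the residue of \<open>x * r\<close>. Then a k = r + n m, and the two angles
    differ by m full turns.\<close>
  obtain x where x: "[a * x = 1] (mod int n)" using cong_solve_coprime_int[OF assms(2)] ..
  obtain k where k: "int k = (x * int r) mod int n"
    using zero_le_imp_eq_int[OF pos_mod_sign[of "int n" "x * int r"]] assms(1) by force
  have "[int k = x * int r] (mod int n)" unfolding k by (rule cong_mod_leftI[OF cong_refl])
  then have "[a * int k = a * (x * int r)] (mod int n)" by (rule cong_scalar_left)
  moreover have "[a * x * int r = 1 * int r] (mod int n)" by (rule cong_scalar_right[OF x])
  ultimately have "[a * int k = int r] (mod int n)" unfolding mult.assoc mult_1 by (rule cong_trans)
  then have "int n dvd a * int k - int r" by (simp only: cong_iff_dvd_diff)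
  then obtain m where "a * int k - int r = int n * m" by (rule dvdE)
  then have "a * int k = int r + int n * m" by linarith
  then have "real_of_int (a * int k) = real_of_int (int r + int n * m)" by (simp only:)
  then have m: "real_of_int a * real k = real r + real n * of_int m" by simp
  have "real k * angle n a = 2 * pi * (real_of_int a * real k) / real n" by (simp add: angle_def)
  also have "\<dots> = 2 * pi * real r / real n + 2 * pi * of_int m"
    unfolding m using assms(1) by (simp add: distrib_left add_divide_distrib)
  finally have "real k * angle n a = 2 * pi * real r / real n + 2 * pi * of_int m" .
  then have "cis (real k * angle n a) = z * cis (2 * pi * of_int m)"
    unfolding r(2) cis_mult by (simp only:)
  then have "cis (real k * angle n a) = z"
    using cis_multiple_2pi[OF Ints_of_int[of m]] by (simp only: mult_1_right)
  moreover have "k < n" using pos_mod_bound[of "int n" "x * int r"] assms(1) unfolding k[symmetric] by simp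
  ultimately show "z \<in> (\<lambda>k. cis (real k * angle n a)) ` {..<n}" by blast
qed


section \<open>The completion in complex coordinates\<close>

text \<open>One abstract frame \<open>F\<close> covers both grids and both rulings; its injectivity
  reduces incidences to equations between pairs of complex numbers.\<close>

locale complex_grid =
  fixes F :: "complex \<times> complex \<Rightarrow> 'b::euclidean_space" and n :: nat
  assumes linear_F: "linear F" and inj_F: "inj F" and n_ge_3: "n \<ge> 3" and odd_n: "odd n"
begin

text \<open>For fixed \<omega> this is real linear in \<open>z\<close> but not complex linear, so
  its range is a real plane, that is, a projective line. In the coordinates given by
  \<open>F\<close> it lies on the quadric |x| = |y|.\<close>

definition emb :: "complex \<Rightarrow> complex \<Rightarrow> 'b"
  where "emb \<omega> z = F (\<omega> * cnj z, \<omega> * z)"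

definition axis :: "complex \<Rightarrow> 'b"
  where "axis x = F (x, 0)"

definition grid_line :: "complex \<Rightarrow> 'b set set"
  where "grid_line \<omega> = proj (range (emb \<omega>))"

definition axis_line :: "'b set set"
  where "axis_line = proj (range axis)"

definition members :: "'b set set set"
  where "members = grid_line ` unity_roots n \<union> {axis_line}"

definition grid_pts :: "'b set set"
  where "grid_pts = {pt (emb \<omega> z) | \<omega> z. \<omega> \<in> unity_roots n \<and> z \<in> unity_roots n}"

definition orbit :: "'b set set"
  where "orbit = (\<lambda>\<omega>. pt (axis (\<i> * \<omega>))) ` unity_roots n"

section \<open>Parametrisation of the grid lines and the axis; membership in the grid and the
  orbit\<close>

lemma n_pos: "n > 0" using n_ge_3 by simp

lemma F_eq_iff: "F v = F w \<longleftrightarrow> v = w"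
  by (rule inj_eq[OF inj_F])

lemma F_lin: "s *\<^sub>R F v + t *\<^sub>R F w = F (s *\<^sub>R v + t *\<^sub>R w)"
  by (simp add: linear_add[OF linear_F] linear_scale[OF linear_F])

lemma F_0: "F 0 = 0"
  by (rule linear_0[OF linear_F])

lemma linear_emb: "linear (emb \<omega>)"
proof -
  have "linear (\<lambda>z. (\<omega> * cnj z, \<omega> * z))" by (rule linearI) (auto simp: algebra_simps)
  from linear_compose[OF this linear_F] show ?thesis by (simp add: emb_def[abs_def] o_def)
qed

lemma linear_axis: "linear axis"
proof -
  have "linear (\<lambda>x::complex. (x, 0::complex))" by (rule linearI) auto
  from linear_compose[OF this linear_F] show ?thesis by (simp add: axis_def[abs_def] o_def)
qed

lemma unity_root_nonzero: "\<omega> \<in> unity_roots n \<Longrightarrow> \<omega> \<noteq> 0"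
  using n_pos by (auto simp: unity_roots_def zero_power)

lemma inj_emb: "\<omega> \<noteq> 0 \<Longrightarrow> inj (emb \<omega>)"
  by (auto simp: inj_def emb_def F_eq_iff)

lemma inj_axis: "inj axis"
  by (auto simp: inj_def axis_def F_eq_iff)

lemma emb_eq_0_iff: "\<omega> \<noteq> 0 \<Longrightarrow> emb \<omega> z = 0 \<longleftrightarrow> z = 0"
  unfolding emb_def F_0[symmetric] F_eq_iff by (auto simp: zero_prod_def)

lemma axis_eq_0_iff: "axis x = 0 \<longleftrightarrow> x = 0"
  unfolding axis_def F_0[symmetric] F_eq_iff by (auto simp: zero_prod_def)

lemma emb_scaleR: "emb \<omega> (t *\<^sub>R z) = t *\<^sub>R emb \<omega> z"
  by (rule linear_scale[OF linear_emb])

lemma axis_scaleR: "axis (t *\<^sub>R z) = t *\<^sub>R axis z"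
  by (rule linear_scale[OF linear_axis])

lemma axis_neq_emb: "\<omega> \<noteq> 0 \<Longrightarrow> z \<noteq> 0 \<Longrightarrow> axis x \<noteq> emb \<omega> z"
  by (auto simp: axis_def emb_def F_eq_iff)

text \<open>Distinct grid lines are skew. Comparing coordinates gives w = d z and cnj w = d cnj z
  with d = \<omega>1 cnj \<omega>2, so d is real and therefore 1.\<close>

lemma emb_eqD:
  assumes "\<omega>1 \<in> unity_roots n" "\<omega>2 \<in> unity_roots n" "z \<noteq> 0" "emb \<omega>1 z = emb \<omega>2 w"
  shows "\<omega>1 = \<omega>2" "z = w"
proof -
  have e: "\<omega>1 * cnj z = \<omega>2 * cnj w" "\<omega>1 * z = \<omega>2 * w"
    using assms(4) by (auto simp: emb_def F_eq_iff)
  let ?d = "\<omega>1 * cnj \<omega>2"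
  have u1: "\<omega>1 * cnj \<omega>1 = 1" and u2: "\<omega>2 * cnj \<omega>2 = 1"
    using unity_roots_mult_cnj[OF n_pos] assms by auto
  have w: "w = ?d * z" using e(2) u2 by (metis mult.assoc mult.commute mult_1)
  have "cnj w = ?d * cnj z" using e(1) u2 by (metis mult.assoc mult.commute mult_1)
  then have "cnj ?d * cnj z = ?d * cnj z" unfolding w by simp
  then have "cnj ?d = ?d" using assms(3) by simp
  then have "Im ?d = 0" by (metis Reals_cnj_iff complex_is_Real_iff)
  then show "\<omega>1 = \<omega>2" using unity_roots_eq_if_Im_eq_0[OF odd_n assms(1,2)] by simp
  then show "z = w" using e(2) unity_root_nonzero[OF assms(2)] by simp
qed

lemma pt_emb_in_grid_pts_iff:
  assumes "\<omega> \<in> unity_roots n" "z \<noteq> 0"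
  shows "pt (emb \<omega> z) \<in> grid_pts \<longleftrightarrow> z \<in> real_power n"
proof
  assume "pt (emb \<omega> z) \<in> grid_pts"
  then obtain \<omega>' z' where h: "\<omega>' \<in> unity_roots n" "z' \<in> unity_roots n" "pt (emb \<omega> z) = pt (emb \<omega>' z')"
    by (auto simp: grid_pts_def)
  obtain t where t: "t \<noteq> 0" "emb \<omega>' z' = emb \<omega> (t *\<^sub>R z)"
    using pt_eqE[OF h(3)] assms unity_root_nonzero by (auto simp: emb_eq_0_iff emb_scaleR)
  then have "z' = t *\<^sub>R z" using emb_eqD(2)[OF h(1) assms(1)] unity_root_nonzero h(2) by auto
  then show "z \<in> real_power n"
    using unity_roots_subset_real_power[OF h(2) n_pos] real_power_scaleR_iff[OF t(1)] by simp
next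
  assume "z \<in> real_power n"
  then obtain t \<zeta> where "t \<noteq> 0" "\<zeta> \<in> unity_roots n" "z = t *\<^sub>R \<zeta>"
    using real_power_decomposition[OF odd_n] by blast
  then show "pt (emb \<omega> z) \<in> grid_pts"
    using assms(1) by (auto simp: grid_pts_def emb_scaleR pt_scaleR)
qed

text \<open>The factor \<open>\<i>\<close> undoes the quarter turn of the orbit: i times i \<omega>
  is -\<omega>, a real multiple of a root of unity.\<close>

lemma pt_axis_in_orbit_iff:
  assumes "x \<noteq> 0"
  shows "pt (axis x) \<in> orbit \<longleftrightarrow> \<i> * x \<in> real_power n"
proof
  assume "pt (axis x) \<in> orbit"
  then obtain \<omega> where w: "\<omega> \<in> unity_roots n" "pt (axis x) = pt (axis (\<i> * \<omega>))"
    by (auto simp: orbit_def)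
  then obtain t where t: "t \<noteq> 0" "axis (\<i> * \<omega>) = axis (t *\<^sub>R x)"
    using pt_eqE[OF w(2)] assms by (auto simp: axis_eq_0_iff axis_scaleR)
  then have "\<i> * \<omega> = t *\<^sub>R x" using inj_axis by (auto simp: inj_def)
  then have "\<i> * (\<i> * \<omega>) = \<i> * (t *\<^sub>R x)" by (simp only:)
  then have "(-1) *\<^sub>R \<omega> = t *\<^sub>R (\<i> * x)" by (simp add: scaleR_conv_of_real mult_ac)
  then show "\<i> * x \<in> real_power n"
    using unity_roots_subset_real_power[OF w(1) n_pos] real_power_scaleR_iff[OF t(1), of "\<i> * x" n]
      real_power_scaleR_iff[of "-1" \<omega> n] by simp
next
  assume "\<i> * x \<in> real_power n"
  then obtain t \<zeta> where t: "t \<noteq> 0" "\<zeta> \<in> unity_roots n" "\<i> * x = t *\<^sub>R \<zeta>"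
    using real_power_decomposition[OF odd_n] by blast
  have "x = - \<i> * (\<i> * x)" by simp
  then have "x = (-t) *\<^sub>R (\<i> * \<zeta>)" unfolding t(3) by simp
  then have "pt (axis x) = pt (axis (\<i> * \<zeta>))"
    using t(1) pt_scaleR[of "-t" "axis (\<i> * \<zeta>)"] by (simp add: axis_scaleR del: scaleR_minus_left)
  then show "pt (axis x) \<in> orbit"
    using t(2) by (auto simp: orbit_def)
qed

lemma pt_emb_notin_orbit:
  assumes "\<omega> \<in> unity_roots n" "z \<noteq> 0"
  shows "pt (emb \<omega> z) \<notin> orbit"
proof
  assume "pt (emb \<omega> z) \<in> orbit"
  then obtain x where "pt (emb \<omega> z) = pt (axis x)" by (auto simp: orbit_def)
  then obtain t where "t \<noteq> 0" "axis x = emb \<omega> (t *\<^sub>R z)"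
    using pt_eqE assms unity_root_nonzero by (metis emb_eq_0_iff emb_scaleR)
  then show False using axis_neq_emb assms unity_root_nonzero by (metis scaleR_eq_0_iff)
qed

lemma pt_axis_notin_grid_pts:
  assumes "x \<noteq> 0"
  shows "pt (axis x) \<notin> grid_pts"
proof
  assume "pt (axis x) \<in> grid_pts"
  then obtain \<omega> z where h: "\<omega> \<in> unity_roots n" "z \<in> unity_roots n" "pt (axis x) = pt (emb \<omega> z)"
    by (auto simp: grid_pts_def)
  then obtain t where "axis (t *\<^sub>R x) = emb \<omega> z"
    using pt_eqE assms by (metis axis_eq_0_iff axis_scaleR)
  then show False using axis_neq_emb h unity_root_nonzero by metis
qed

section \<open>Distinctness of the members and incidence with them\<close>

lemma inj_on_grid_line: "inj_on grid_line (unity_roots n)"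
proof (rule inj_onI)
  fix \<omega>1 \<omega>2 assume w: "\<omega>1 \<in> unity_roots n" "\<omega>2 \<in> unity_roots n" "grid_line \<omega>1 = grid_line \<omega>2"
  have 1: "emb \<omega>1 1 \<noteq> 0" using emb_eq_0_iff unity_root_nonzero[OF w(1)] by simp
  have "pt (emb \<omega>1 1) \<in> grid_line \<omega>2" unfolding w(3)[symmetric] using 1 by (auto simp: grid_line_def proj_def)
  then have "emb \<omega>1 1 \<in> range (emb \<omega>2)"
    unfolding grid_line_def
    using pt_in_proj[OF linear_subspace_image[OF linear_emb subspace_UNIV] 1, of \<omega>2] by blast
  then show "\<omega>1 = \<omega>2" using emb_eqD(1)[OF w(1,2), of 1] by auto
qed

lemma grid_line_neq_axis_line:
  assumes "\<omega> \<in> unity_roots n"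
  shows "grid_line \<omega> \<noteq> axis_line"
proof
  assume eq: "grid_line \<omega> = axis_line"
  have 1: "axis 1 \<noteq> 0" by (simp add: axis_eq_0_iff)
  then have "pt (axis 1) \<in> grid_line \<omega>" unfolding eq by (auto simp: axis_line_def proj_def)
  then have "axis 1 \<in> range (emb \<omega>)"
    unfolding grid_line_def
    using pt_in_proj[OF linear_subspace_image[OF linear_emb subspace_UNIV] 1, of \<omega>] by blast
  then show False
    using 1 axis_neq_emb unity_root_nonzero[OF assms] linear_0[OF linear_emb] by (metis imageE)
qed

lemma meets_grid_line_iff:
  assumes "subspace W" "\<omega> \<in> unity_roots n"
  shows "proj W \<inter> grid_line \<omega> \<noteq> {} \<longleftrightarrow> (\<exists>z. z \<noteq> 0 \<and> emb \<omega> z \<in> W)"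
  unfolding grid_line_def proj_meets_iff[OF assms(1)]
  using emb_eq_0_iff[OF unity_root_nonzero[OF assms(2)]] by auto

lemma meets_axis_line_iff:
  assumes "subspace W"
  shows "proj W \<inter> axis_line \<noteq> {} \<longleftrightarrow> (\<exists>x. x \<noteq> 0 \<and> axis x \<in> W)"
  unfolding axis_line_def proj_meets_iff[OF assms(1)]
  using axis_eq_0_iff by auto

lemma finite_unity_roots: "finite (unity_roots n)"
  using finite_roots_unity[of n] n_ge_3 by (simp add: unity_roots_def)

lemma finite_members: "finite members"
  by (simp add: members_def finite_unity_roots)

lemma proj_line_members: "m \<in> members \<Longrightarrow> proj_line m"
  using proj_line_range[OF linear_emb inj_emb] proj_line_range[OF linear_axis inj_axis]
    unity_root_nonzero by (auto simp: members_def grid_line_def axis_line_def)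

section \<open>Lines meeting at least three members\<close>

lemma transversal_grid_lines:
  assumes "card {m \<in> members. l \<inter> m \<noteq> {}} \<ge> 3"
  obtains \<omega>1 \<omega>2 where "\<omega>1 \<in> unity_roots n" "\<omega>2 \<in> unity_roots n" "\<omega>1 \<noteq> \<omega>2"
    "l \<inter> grid_line \<omega>1 \<noteq> {}" "l \<inter> grid_line \<omega>2 \<noteq> {}"
proof -
  let ?T = "{\<omega> \<in> unity_roots n. l \<inter> grid_line \<omega> \<noteq> {}}"
  have T: "finite ?T" using finite_unity_roots by simp
  have sub: "{m \<in> members. l \<inter> m \<noteq> {}} \<subseteq> insert axis_line (grid_line ` ?T)"
    by (auto simp: members_def)
  have "3 \<le> card (insert axis_line (grid_line ` ?T))"
    using card_mono[OF _ sub] assms T by simp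
  \<comment> \<open>The axis accounts for at most one of the three members, which leaves two grid
    lines.\<close>
  also have "\<dots> \<le> Suc (card ?T)"
    using card_image_le[OF T, of grid_line] T by (simp add: card_insert_if)
  finally have "2 \<le> card ?T" by simp
  then obtain S where "S \<subseteq> ?T" "card S = 2" by (meson obtain_subset_with_card_n)
  then obtain x y where "x \<in> ?T" "y \<in> ?T" "x \<noteq> y" unfolding card_2_iff by blast
  then show thesis using that by auto
qed

lemma meets_axis_line_if_few_grid_lines:
  assumes "card {m \<in> members. l \<inter> m \<noteq> {}} \<ge> 3"
    and "\<And>\<omega>. \<omega> \<in> unity_roots n \<Longrightarrow> l \<inter> grid_line \<omega> \<noteq> {} \<Longrightarrow> \<omega> = \<omega>1 \<or> \<omega> = \<omega>2"
  shows "l \<inter> axis_line \<noteq> {}"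
proof
  assume no: "l \<inter> axis_line = {}"
  have "{m \<in> members. l \<inter> m \<noteq> {}} \<subseteq> {grid_line \<omega>1, grid_line \<omega>2}"
    using no assms(2) by (auto simp: members_def)
  then have "card {m \<in> members. l \<inter> m \<noteq> {}} \<le> card {grid_line \<omega>1, grid_line \<omega>2}"
    by (intro card_mono) auto
  also have "\<dots> \<le> 2" by (simp add: card_insert_if)
  finally show False using assms(1) by simp
qed

text \<open>Both summands are isotropic for the form |x|^2 - |y|^2, so its value on the sum is only
  the polar term. That term vanishes iff one of the two imaginary parts does.\<close>

lemma sum_norm_identity:
  "cmod (\<omega> * cnj z + \<eta> * cnj w) ^ 2 - cmod (\<omega> * z + \<eta> * w) ^ 2
    = 4 * Im (\<omega> * cnj \<eta>) * Im (z * cnj w)"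
  unfolding cmod_power2 by (simp add: power2_eq_square) algebra

text \<open>
  \<open>P\<close> tells whether the intersection points of the line with the arrangement belong to the
  completion; the content is that \<open>P\<close> does not depend on the point.
\<close>

lemma transversal_uniform:
  assumes W: "subspace W" "dim W = 2" and card: "card {m \<in> members. proj W \<inter> m \<noteq> {}} \<ge> 3"
  obtains P where
    "\<And>\<omega> z. \<omega> \<in> unity_roots n \<Longrightarrow> z \<noteq> 0 \<Longrightarrow> emb \<omega> z \<in> W \<Longrightarrow> z \<in> real_power n \<longleftrightarrow> P"
    "\<And>x. x \<noteq> 0 \<Longrightarrow> axis x \<in> W \<Longrightarrow> \<i> * x \<in> real_power n \<longleftrightarrow> P"
proof -
  obtain \<omega>1 \<omega>2 where \<omega>: "\<omega>1 \<in> unity_roots n" "\<omega>2 \<in> unity_roots n" "\<omega>1 \<noteq> \<omega>2"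
    and m: "proj W \<inter> grid_line \<omega>1 \<noteq> {}" "proj W \<inter> grid_line \<omega>2 \<noteq> {}"
    using transversal_grid_lines[OF card] .
  obtain z1 z2 where z: "z1 \<noteq> 0" "emb \<omega>1 z1 \<in> W" "z2 \<noteq> 0" "emb \<omega>2 z2 \<in> W"
    using m meets_grid_line_iff[OF W(1)] \<omega> by metis
  have nz: "emb \<omega>1 z1 \<noteq> 0" using z \<omega> emb_eq_0_iff unity_root_nonzero by metis
  have ni: "emb \<omega>2 z2 \<notin> span {emb \<omega>1 z1}"
  proof
    assume "emb \<omega>2 z2 \<in> span {emb \<omega>1 z1}"
    then obtain t where "emb \<omega>2 z2 = emb \<omega>1 (t *\<^sub>R z1)" by (auto simp: span_singleton emb_scaleR)
    then show False using emb_eqD(1)[OF \<omega>(2,1) z(3)] \<omega>(3) by auto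
  qed
  \<comment> \<open>The two skew lines span the plane, so each vector of \<open>W\<close> is a sum
    of one vector from each; the real coefficients are absorbed into the parameters.\<close>
  have dec: "\<exists>s t. x = \<omega>1 * cnj (s *\<^sub>R z1) + \<omega>2 * cnj (t *\<^sub>R z2) \<and> y = \<omega>1 * (s *\<^sub>R z1) + \<omega>2 * (t *\<^sub>R z2)"
    if xy: "F (x, y) \<in> W" for x y
  proof -
    obtain s t where "F (x, y) = s *\<^sub>R emb \<omega>1 z1 + t *\<^sub>R emb \<omega>2 z2"
      using plane_decomposition[OF W z(2,4) xy nz ni] .
    then have "x = \<omega>1 * cnj (s *\<^sub>R z1) + \<omega>2 * cnj (t *\<^sub>R z2) \<and> y = \<omega>1 * (s *\<^sub>R z1) + \<omega>2 * (t *\<^sub>R z2)"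
      unfolding emb_def F_lin F_eq_iff by (simp add: algebra_simps)
    then show ?thesis by blast
  qed
  define d where "d = \<omega>1 * cnj \<omega>2"
  have d: "Im d \<noteq> 0"
    using unity_roots_eq_if_Im_eq_0[OF odd_n \<omega>(1,2)] \<omega>(3) unfolding d_def by auto
  have d_power: "d \<in> real_power n"
    unfolding d_def using unity_roots_subset_real_power n_pos \<omega> unity_roots_mult unity_roots_cnj by blast
  have u2: "\<omega>2 * cnj \<omega>2 = 1"
    using unity_roots_mult_cnj[OF n_pos \<omega>(2)] .
  show thesis
  proof (cases "Im (z2 * cnj z1) = 0")
    case True \<comment> \<open>the line belongs to the opposite ruling\<close>
    have par: "z2 * cnj z1 = cnj z2 * z1" using True by (simp add: complex_eq_iff)
    \<comment> \<open>This equation describes the line of the opposite ruling. The first generator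
      satisfies it identically and the second one by \<open>par\<close>.\<close>
    have opp: "x * z1 = y * cnj z1" if "F (x, y) \<in> W" for x y
    proof -
      obtain s t where st: "x = \<omega>1 * cnj (s *\<^sub>R z1) + \<omega>2 * cnj (t *\<^sub>R z2)"
        "y = \<omega>1 * (s *\<^sub>R z1) + \<omega>2 * (t *\<^sub>R z2)" using dec[OF \<open>F (x, y) \<in> W\<close>] by blast
      have "y * cnj z1 - x * z1 = of_real t * \<omega>2 * (z2 * cnj z1 - cnj z2 * z1)"
        unfolding st by (simp add: scaleR_conv_of_real algebra_simps)
      then show ?thesis using par by simp
    qed
    show thesis
    proof (rule that[of "z1 \<in> real_power n"])
      fix \<omega> z assume a: "\<omega> \<in> unity_roots n" "z \<noteq> 0" "emb \<omega> z \<in> W"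
      then have "\<omega> * (cnj z * z1) = \<omega> * (z * cnj z1)"
        using opp[of "\<omega> * cnj z" "\<omega> * z"] by (simp only: emb_def mult.assoc)
      then have "cnj z * z1 = z * cnj z1" using unity_root_nonzero[OF a(1)] by simp
      then have "Im (z * cnj z1) = 0" by (simp add: complex_eq_iff algebra_simps)
      then show "z \<in> real_power n \<longleftrightarrow> z1 \<in> real_power n"
        using real_power_parallel a(2) z(1) by blast
    next
      \<comment> \<open>Vacuous: on the axis the second coordinate is 0, so \<open>opp\<close> would
        give x z1 = 0.\<close>
      fix x assume "x \<noteq> 0" "axis x \<in> W"
      then show "\<i> * x \<in> real_power n \<longleftrightarrow> z1 \<in> real_power n"
        using opp[of x 0] z(1) by (simp add: axis_def)
    qed
  next
    case False \<comment> \<open>the line leaves the quadric, hence meets no further grid line\<close>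
    have two: "(\<omega> = \<omega>1 \<and> (\<exists>s. z = s *\<^sub>R z1)) \<or> (\<omega> = \<omega>2 \<and> (\<exists>t. z = t *\<^sub>R z2))"
      if a: "\<omega> \<in> unity_roots n" "z \<noteq> 0" "emb \<omega> z \<in> W" for \<omega> z
    proof -
      obtain s t where st: "\<omega> * cnj z = \<omega>1 * cnj (s *\<^sub>R z1) + \<omega>2 * cnj (t *\<^sub>R z2)"
        "\<omega> * z = \<omega>1 * (s *\<^sub>R z1) + \<omega>2 * (t *\<^sub>R z2)" using dec a(3) unfolding emb_def by blast
      \<comment> \<open>A grid line lies on the quadric, so the polar term must vanish. Its other
        factors being nonzero, one of \<open>s\<close>, \<open>t\<close> is 0.\<close>
      have "cmod (\<omega> * cnj z) = cmod (\<omega> * z)" by (simp add: norm_mult)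
      then have "4 * Im d * Im ((s *\<^sub>R z1) * cnj (t *\<^sub>R z2)) = 0"
        using sum_norm_identity[of \<omega>1 "s *\<^sub>R z1" \<omega>2 "t *\<^sub>R z2"] unfolding st d_def by (simp only: diff_self)
      then have "s * t * Im (z2 * cnj z1) = 0" using d by (auto simp: algebra_simps)
      then have "s = 0 \<or> t = 0" using False by simp
      then show ?thesis
      proof
        assume "s = 0"
        then have "emb \<omega> z = emb \<omega>2 (t *\<^sub>R z2)" unfolding emb_def st by simp
        from emb_eqD[OF a(1) \<omega>(2) a(2) this] show ?thesis by blast
      next
        assume "t = 0"
        then have "emb \<omega> z = emb \<omega>1 (s *\<^sub>R z1)" unfolding emb_def st by simp
        from emb_eqD[OF a(1) \<omega>(1) a(2) this] show ?thesis by blast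
      qed
    qed
    have ax: "(z2 \<in> real_power n \<longleftrightarrow> z1 \<in> real_power n) \<and> (\<i> * x \<in> real_power n \<longleftrightarrow> z1 \<in> real_power n)"
      if x0: "x \<noteq> 0" and xW: "axis x \<in> W" for x
    proof -
      obtain s t where st: "x = \<omega>1 * cnj (s *\<^sub>R z1) + \<omega>2 * cnj (t *\<^sub>R z2)"
        "0 = \<omega>1 * (s *\<^sub>R z1) + \<omega>2 * (t *\<^sub>R z2)" using dec xW unfolding axis_def by blast
      have nz: "\<omega>1 * z1 \<noteq> 0" "\<omega>2 * z2 \<noteq> 0"
        using z unity_root_nonzero[OF \<omega>(1)] unity_root_nonzero[OF \<omega>(2)] by auto
      \<comment> \<open>A nonzero first coordinate needs one nonzero coefficient; the vanishing
        second coordinate then forces the other to be nonzero.\<close>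
      have "s \<noteq> 0 \<or> t \<noteq> 0" using st(1) x0 by auto
      then have s: "s \<noteq> 0" and t: "t \<noteq> 0"
        using st(2) nz by (force simp: mult_scaleR_right)+
      define p q where "p = s *\<^sub>R z1" and "q = t *\<^sub>R z2"
      \<comment> \<open>Multiplying the vanishing second coordinate by \<open>cnj \<omega>2\<close>
        solves it for \<open>q\<close>.\<close>
      have "d * p + (\<omega>2 * cnj \<omega>2) * q = cnj \<omega>2 * (\<omega>1 * p + \<omega>2 * q)"
        unfolding d_def by (simp add: algebra_simps)
      then have q: "q = - (d * p)"
        using st(2) u2 unfolding p_def q_def by (simp add: eq_neg_iff_add_eq_0 add.commute)
      have "\<omega>2 * d = \<omega>1 * (\<omega>2 * cnj \<omega>2)" unfolding d_def by (simp only: ac_simps)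
      then have "x = (\<omega>2 * d) * cnj p + \<omega>2 * cnj q"
        using st(1) u2 unfolding p_def q_def by simp
      \<comment> \<open>The last factor is purely imaginary, which is why \<open>\<i> * x\<close>
        rather than \<open>x\<close> is a real multiple of \<open>\<omega>2 * cnj p\<close>.\<close>
      also have "\<dots> = \<omega>2 * cnj p * (d - cnj d)" unfolding q by (simp add: algebra_simps)
      also have "d - cnj d = \<i> * of_real (2 * Im d)" by (simp add: complex_eq_iff)
      finally have x: "\<i> * x = (- 2 * Im d) *\<^sub>R (\<omega>2 * cnj p)"
        by (simp add: scaleR_conv_of_real algebra_simps)
      have "z2 \<in> real_power n \<longleftrightarrow> (-1) *\<^sub>R q \<in> real_power n"
        unfolding q_def scaleR_scaleR using real_power_scaleR_iff[of "-1 * t" z2 n] t by simp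
      also have "(-1) *\<^sub>R q = (s *\<^sub>R (d * z1))" unfolding q p_def by simp
      also have "s *\<^sub>R (d * z1) \<in> real_power n \<longleftrightarrow> z1 \<in> real_power n"
        unfolding real_power_scaleR_iff[OF s] by (rule real_power_mult_iff[OF d_power])
      finally have "z2 \<in> real_power n \<longleftrightarrow> z1 \<in> real_power n" .
      moreover have "\<i> * x \<in> real_power n \<longleftrightarrow> cnj p \<in> real_power n"
        unfolding x using d unity_roots_subset_real_power[OF \<omega>(2) n_pos]
        by (subst real_power_scaleR_iff) (simp_all add: real_power_mult_iff)
      moreover have "cnj p \<in> real_power n \<longleftrightarrow> z1 \<in> real_power n"
        unfolding real_power_cnj_iff p_def by (rule real_power_scaleR_iff[OF s])
      ultimately show ?thesis by simp
    qed
    \<comment> \<open>By \<open>two\<close> only two grid lines are met, so the third member is the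
      axis. Its intersection point is what links \<open>z1\<close> and \<open>z2\<close> through
      \<open>ax\<close>.\<close>
    have "proj W \<inter> axis_line \<noteq> {}"
    proof (rule meets_axis_line_if_few_grid_lines[OF card])
      fix \<omega> assume "\<omega> \<in> unity_roots n" "proj W \<inter> grid_line \<omega> \<noteq> {}"
      then show "\<omega> = \<omega>1 \<or> \<omega> = \<omega>2" using meets_grid_line_iff[OF W(1)] two by blast
    qed
    then obtain x0 where x0: "x0 \<noteq> 0" "axis x0 \<in> W" using meets_axis_line_iff[OF W(1)] by blast
    show thesis
    proof (rule that[of "z1 \<in> real_power n"])
      fix \<omega> z assume a: "\<omega> \<in> unity_roots n" "z \<noteq> 0" "emb \<omega> z \<in> W"
      show "z \<in> real_power n \<longleftrightarrow> z1 \<in> real_power n"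
        using two[OF a] ax[OF x0] a(2) real_power_scaleR_iff by auto
    next
      fix x assume "x \<noteq> 0" "axis x \<in> W"
      then show "\<i> * x \<in> real_power n \<longleftrightarrow> z1 \<in> real_power n" using ax by blast
    qed
  qed
qed

section \<open>The orbit completes the grid\<close>

lemma in_completion_emb:
  "\<omega> \<in> unity_roots n \<Longrightarrow> z \<noteq> 0 \<Longrightarrow> pt (emb \<omega> z) \<in> grid_pts \<union> orbit \<longleftrightarrow> z \<in> real_power n"
  using pt_emb_in_grid_pts_iff pt_emb_notin_orbit by auto

lemma in_completion_axis:
  "x \<noteq> 0 \<Longrightarrow> pt (axis x) \<in> grid_pts \<union> orbit \<longleftrightarrow> \<i> * x \<in> real_power n"
  using pt_axis_in_orbit_iff pt_axis_notin_grid_pts by auto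

lemma completion_cases:
  assumes "p \<in> grid_pts \<union> orbit"
  obtains \<omega> z where "\<omega> \<in> unity_roots n" "z \<noteq> 0" "p = pt (emb \<omega> z)"
  | x where "x \<noteq> 0" "p = pt (axis x)"
proof -
  consider \<omega> z where "\<omega> \<in> unity_roots n" "z \<in> unity_roots n" "p = pt (emb \<omega> z)"
    | \<omega> where "\<omega> \<in> unity_roots n" "p = pt (axis (\<i> * \<omega>))"
    using assms by (auto simp: grid_pts_def orbit_def)
  then show thesis
  proof cases
    case 1
    then show thesis using that(1) unity_root_nonzero by blast
  next
    case (2 \<omega>)
    then show thesis using that(2)[of "\<i> * \<omega>"] unity_root_nonzero[of \<omega>] by simp
  qed
qed

lemma member_point_cases:
  assumes "m \<in> members" "p \<in> m"
  obtains \<omega> z where "\<omega> \<in> unity_roots n" "z \<noteq> 0" "p = pt (emb \<omega> z)"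
  | x where "x \<noteq> 0" "p = pt (axis x)"
proof -
  from assms(1) consider \<omega> where "\<omega> \<in> unity_roots n" "m = grid_line \<omega>" | "m = axis_line"
    by (auto simp: members_def)
  then show thesis
  proof cases
    case (1 \<omega>)
    then obtain z where z: "emb \<omega> z \<noteq> 0" "p = pt (emb \<omega> z)"
      using assms(2) unfolding grid_line_def proj_def by blast
    then show thesis using that(1)[OF 1(1), of z] linear_0[OF linear_emb] by metis
  next
    case 2
    then obtain x where x: "axis x \<noteq> 0" "p = pt (axis x)"
      using assms(2) unfolding axis_line_def proj_def by blast
    then show thesis using that(2)[of x] by (simp add: axis_eq_0_iff)
  qed
qed

lemma finite_grid_pts: "finite grid_pts"
proof -
  have "grid_pts = (\<lambda>(\<omega>, z). pt (emb \<omega> z)) ` (unity_roots n \<times> unity_roots n)"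
    unfolding grid_pts_def by force
  then show ?thesis using finite_unity_roots by simp
qed

lemma finite_orbit: "finite orbit"
  by (simp add: orbit_def finite_unity_roots)

lemma grid_pts_proj: "grid_pts \<subseteq> proj UNIV"
proof
  fix p assume "p \<in> grid_pts"
  then obtain \<omega> z where "\<omega> \<in> unity_roots n" "z \<in> unity_roots n" "p = pt (emb \<omega> z)"
    by (auto simp: grid_pts_def)
  moreover from this have "emb \<omega> z \<noteq> 0" using emb_eq_0_iff unity_root_nonzero by metis
  ultimately show "p \<in> proj UNIV" unfolding proj_def by blast
qed

lemma orbit_subset_axis_line: "orbit \<subseteq> axis_line"
proof
  fix p assume "p \<in> orbit"
  then obtain \<omega> where "\<omega> \<in> unity_roots n" "p = pt (axis (\<i> * \<omega>))" by (auto simp: orbit_def)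
  moreover from this have "axis (\<i> * \<omega>) \<noteq> 0" by (simp add: axis_eq_0_iff unity_root_nonzero)
  ultimately show "p \<in> axis_line" unfolding axis_line_def proj_def by blast
qed

lemma orbit_proj: "orbit \<subseteq> proj UNIV"
  using orbit_subset_axis_line unfolding axis_line_def proj_def by blast

lemma completes_orbit: "completes grid_pts members orbit"
  unfolding completes_def collinearly_complete_def
proof (intro conjI allI impI ballI)
  fix l m assume l: "proj_line l \<and> 3 \<le> card {m \<in> members. l \<inter> m \<noteq> {}} \<and> l \<inter> (grid_pts \<union> orbit) \<noteq> {}"
    and m: "m \<in> members"
  obtain W where W: "subspace W" "dim W = 2" "l = proj W" using l by (auto simp: proj_line_def)
  obtain P where P: "\<And>\<omega> z. \<omega> \<in> unity_roots n \<Longrightarrow> z \<noteq> 0 \<Longrightarrow> emb \<omega> z \<in> W \<Longrightarrow> z \<in> real_power n \<longleftrightarrow> P"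
    "\<And>x. x \<noteq> 0 \<Longrightarrow> axis x \<in> W \<Longrightarrow> \<i> * x \<in> real_power n \<longleftrightarrow> P"
    by (rule transversal_uniform[OF W(1,2)]) (use l in \<open>simp_all add: W(3)\<close>)
  have emb_W: "pt (emb \<omega> z) \<in> l \<longleftrightarrow> emb \<omega> z \<in> W" if "\<omega> \<in> unity_roots n" "z \<noteq> 0" for \<omega> z
    unfolding W(3) using that pt_in_proj[OF W(1), of "emb \<omega> z"] emb_eq_0_iff[OF unity_root_nonzero, of \<omega> z]
    by simp
  have axis_W: "pt (axis x) \<in> l \<longleftrightarrow> axis x \<in> W" if "x \<noteq> 0" for x
    unfolding W(3) using that pt_in_proj[OF W(1), of "axis x"] axis_eq_0_iff[of x] by simp
  obtain p where p: "p \<in> l" "p \<in> grid_pts \<union> orbit" using l by auto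
  \<comment> \<open>One point of \<open>l\<close> in the completion makes \<open>P\<close> true, and
    \<open>P\<close> in turn puts every intersection point into the completion.\<close>
  from p(2) have P
  proof (cases rule: completion_cases)
    case (1 \<omega> z)
    then show ?thesis using p P(1)[of \<omega> z] emb_W[of \<omega> z] in_completion_emb[of \<omega> z] by simp
  next
    case (2 x)
    then show ?thesis using p P(2)[of x] axis_W[of x] in_completion_axis[of x] by simp
  qed
  show "l \<inter> m \<subseteq> grid_pts \<union> orbit"
  proof
    fix q assume "q \<in> l \<inter> m"
    then have q: "q \<in> l" "q \<in> m" by auto
    from m q(2) show "q \<in> grid_pts \<union> orbit"
    proof (cases rule: member_point_cases)
      case (1 \<omega> z)
      then show ?thesis using q \<open>P\<close> P(1)[of \<omega> z] emb_W[of \<omega> z] in_completion_emb[of \<omega> z] by simp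
    next
      case (2 x)
      then show ?thesis using q \<open>P\<close> P(2)[of x] axis_W[of x] in_completion_axis[of x] by simp
    qed
  qed
next
  show "finite (grid_pts \<union> orbit)" using finite_grid_pts finite_orbit by simp
  show "grid_pts \<union> orbit \<subseteq> proj UNIV" using grid_pts_proj orbit_proj by simp
qed (fact finite_orbit orbit_proj finite_members proj_line_members)+

section \<open>Minimality and size of the orbit\<close>

text \<open>
  Through any point of the axis line there is a transversal to two given grid lines \<open>\<omega>\<close> and \<open>1\<close>;
  for points of the orbit it passes through grid points.
\<close>

lemma orbit_subset_completion:
  assumes Y: "completes grid_pts members Y"
  shows "orbit \<subseteq> Y"
proof
  fix p assume "p \<in> orbit"
  then obtain \<zeta> where \<zeta>: "\<zeta> \<in> unity_roots n" "p = pt (axis (\<i> * \<zeta>))" by (auto simp: orbit_def)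
  obtain \<omega> where \<omega>: "\<omega> \<in> unity_roots n" "\<omega> \<noteq> 1" using unity_roots_nontrivial[OF n_ge_3] .
  \<comment> \<open>The choice of \<open>w\<close> gives \<omega> w = z, so the second coordinates
    of \<open>emb 1 z\<close> and \<open>emb \<omega> w\<close> cancel in the difference. The choice
    of \<open>z\<close> turns the first coordinate into \<zeta> (cnj \<omega> - \<omega>), a real
    multiple of i \<zeta>.\<close>
  define z where "z = \<omega> * cnj \<zeta>"
  define w where "w = cnj \<omega> * z"
  define W where "W = span {emb 1 z, emb \<omega> w}"
  have z: "z \<in> unity_roots n" "w \<in> unity_roots n"
    unfolding z_def w_def using \<omega> \<zeta> by (simp_all add: unity_roots_mult unity_roots_cnj)
  then have nz: "z \<noteq> 0" "w \<noteq> 0" using unity_root_nonzero by auto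
  have im: "Im \<omega> \<noteq> 0" using unity_roots_eq_if_Im_eq_0[OF odd_n \<omega>(1) one_unity_root] \<omega>(2) by auto
  have u: "\<omega> * cnj \<omega> = 1" using unity_roots_mult_cnj[OF n_pos \<omega>(1)] .
  have sub: "subspace W" unfolding W_def by (rule subspace_span)
  have in_W: "emb 1 z \<in> W" "emb \<omega> w \<in> W" unfolding W_def by (auto intro: span_base)
  have ni: "emb 1 z \<notin> span {emb \<omega> w}"
  proof
    assume "emb 1 z \<in> span {emb \<omega> w}"
    then obtain t where "emb 1 z = emb \<omega> (t *\<^sub>R w)" by (auto simp: span_singleton emb_scaleR)
    then show False using emb_eqD(1)[OF one_unity_root \<omega>(1) nz(1)] \<omega>(2) by blast
  qed
  then have ne: "emb 1 z \<noteq> emb \<omega> w" by (auto intro: span_base)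
  have "emb \<omega> w \<noteq> 0" using emb_eq_0_iff unity_root_nonzero[OF \<omega>(1)] nz by simp
  then have "independent {emb 1 z, emb \<omega> w}" using ni by (simp add: independent_insert)
  then have dim: "dim W = 2" unfolding W_def using ne by (simp add: dim_eq_card_independent)
  have ax: "axis (\<i> * \<zeta>) \<in> W"
  proof -
    have w: "\<omega> * w = z" unfolding w_def using u by (metis mult.assoc mult_1)
    have "emb 1 z - emb \<omega> w = axis (cnj z - \<omega> * cnj w)"
      unfolding emb_def axis_def w linear_diff[OF linear_F, symmetric] by simp
    also have "cnj z - \<omega> * cnj w = \<zeta> * (cnj \<omega> - \<omega> * (\<omega> * cnj \<omega>))"
      unfolding w_def z_def by (simp add: algebra_simps)
    also have "\<dots> = (- 2 * Im \<omega>) *\<^sub>R (\<i> * \<zeta>)"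
      unfolding u by (simp add: complex_eq_iff algebra_simps)
    finally have "(- 2 * Im \<omega>) *\<^sub>R axis (\<i> * \<zeta>) \<in> W"
      using subspace_diff[OF sub in_W] by (simp only: axis_scaleR)
    then have "(1 / (- 2 * Im \<omega>)) *\<^sub>R (- 2 * Im \<omega>) *\<^sub>R axis (\<i> * \<zeta>) \<in> W"
      by (rule subspace_scale[OF sub])
    then show ?thesis using im by simp
  qed
  have x: "\<i> * \<zeta> \<noteq> 0" using unity_root_nonzero[OF \<zeta>(1)] by simp
  have "proj W \<inter> grid_line 1 \<noteq> {}" "proj W \<inter> grid_line \<omega> \<noteq> {}" "proj W \<inter> axis_line \<noteq> {}"
    using meets_grid_line_iff[OF sub one_unity_root] meets_grid_line_iff[OF sub \<omega>(1)]
      meets_axis_line_iff[OF sub] in_W ax nz x by blast+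
  then have "{grid_line 1, grid_line \<omega>, axis_line} \<subseteq> {m \<in> members. proj W \<inter> m \<noteq> {}}"
    using \<omega>(1) by (simp add: members_def)
  moreover have "card {grid_line 1, grid_line \<omega>, axis_line} = 3"
    using grid_line_neq_axis_line[OF one_unity_root] grid_line_neq_axis_line[OF \<omega>(1)] \<omega>
      inj_onD[OF inj_on_grid_line, of 1 \<omega>]
    by (simp add: card_insert_if) blast
  ultimately have card: "3 \<le> card {m \<in> members. proj W \<inter> m \<noteq> {}}"
    using card_mono[of "{m \<in> members. proj W \<inter> m \<noteq> {}}" "{grid_line 1, grid_line \<omega>, axis_line}"]
      finite_members by simp
  have "pt (emb 1 z) \<in> proj W"
    using pt_in_proj[OF sub, of "emb 1 z"] in_W nz emb_eq_0_iff[of 1 z] by simp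
  moreover have "pt (emb 1 z) \<in> grid_pts"
    unfolding grid_pts_def using one_unity_root z(1) by blast
  ultimately have "proj W \<inter> (grid_pts \<union> Y) \<noteq> {}" by blast
  moreover have "proj_line (proj W)" unfolding proj_line_def using sub dim by blast
  moreover have "\<forall>l. proj_line l \<and> 3 \<le> card {m \<in> members. l \<inter> m \<noteq> {}} \<and> l \<inter> (grid_pts \<union> Y) \<noteq> {}
      \<longrightarrow> (\<forall>m\<in>members. l \<inter> m \<subseteq> grid_pts \<union> Y)"
    using Y unfolding completes_def collinearly_complete_def by (elim conjE)
  moreover have "axis_line \<in> members" by (simp add: members_def)
  ultimately have "proj W \<inter> axis_line \<subseteq> grid_pts \<union> Y" using card by simp
  moreover have "p \<in> proj W \<inter> axis_line"
    using ax x axis_eq_0_iff unfolding \<zeta>(2) by (auto simp: proj_def axis_line_def)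
  \<comment> \<open>Completeness puts \<open>p\<close> into the grid or \<open>Y\<close>, and no
    axis point is a grid point.\<close>
  ultimately show "p \<in> Y" using pt_axis_notin_grid_pts[OF x] \<zeta>(2) by auto
qed

lemma smallest_completion_iff: "smallest_completion grid_pts members X \<longleftrightarrow> X = orbit"
  using completes_orbit orbit_subset_completion by (auto simp: smallest_completion_def)

text \<open>Two roots give the same point only if they are real multiples of each other, and for odd
  n this forces equality.\<close>

lemma card_orbit: "card orbit = n"
proof -
  have "inj_on (\<lambda>\<omega>. pt (axis (\<i> * \<omega>))) (unity_roots n)"
  proof (rule inj_onI)
    fix \<omega>1 \<omega>2 assume w: "\<omega>1 \<in> unity_roots n" "\<omega>2 \<in> unity_roots n"
      and eq: "pt (axis (\<i> * \<omega>1)) = pt (axis (\<i> * \<omega>2))"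
    have "axis (\<i> * \<omega>1) \<noteq> 0" using w unity_root_nonzero by (simp add: axis_eq_0_iff)
    from pt_eqE[OF eq this] obtain t where "axis (\<i> * \<omega>2) = axis (t *\<^sub>R (\<i> * \<omega>1))"
      by (metis axis_scaleR)
    then have "\<i> * \<omega>2 = \<i> * (t *\<^sub>R \<omega>1)" using injD[OF inj_axis] by simp
    then have "\<omega>2 = t *\<^sub>R \<omega>1" by (simp only: mult_cancel_left) simp
    then have "Im (\<omega>1 * cnj \<omega>2) = 0" by simp
    then show "\<omega>1 = \<omega>2" using unity_roots_eq_if_Im_eq_0[OF odd_n w] by simp
  qed
  then have "card orbit = card (unity_roots n)" unfolding orbit_def by (rule card_image)
  also have "\<dots> = n"
    unfolding unity_roots_def using n_ge_3 by (intro card_roots_unity_eq) auto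
  finally show ?thesis .
qed

end


section \<open>The two rulings of the two grids\<close>

definition vec2 :: "complex \<Rightarrow> real^2"
  where "vec2 z = vector [Re z, Im z]"

lemma linear_vec2: "linear vec2"
  by (rule linearI) (simp_all add: vec2_def vec_eq_iff forall_2)

lemma vec2_eq_iff: "vec2 z = vec2 w \<longleftrightarrow> z = w"
  by (auto simp: vec2_def vec_eq_iff forall_2 complex_eq_iff)

lemma surj_vec2: "surj vec2"
  by (rule surjI[of _ "\<lambda>x. Complex (x $ 1) (x $ 2)"]) (simp add: vec2_def vec_eq_iff forall_2)

lemma u_eq_vec2: "u \<theta> = vec2 (cis \<theta>)"
  by (simp add: u_def vec2_def)

fun weights :: "grid_kind \<Rightarrow> real \<Rightarrow> real \<times> real"
  where "weights Grid_A c = (1, - c)" | "weights Grid_B c = (c, 1)"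

text \<open>
  Exchanging the rulings swaps the roles of \<open>i\<close>, \<open>j\<close>, replaces \<open>(\<alpha>, \<beta>)\<close> by \<open>(\<beta>, -\<alpha>)\<close> and swaps
  the coordinates; the complex conjugate corrects the sign of \<open>i\<alpha> - j\<beta>\<close>.
\<close>

fun frame :: "ruling \<Rightarrow> grid_kind \<Rightarrow> real \<Rightarrow> complex \<times> complex \<Rightarrow> vec4"
  where
    "frame Fix_First g c (x, y) = (fst (weights g c) *\<^sub>R vec2 x, snd (weights g c) *\<^sub>R vec2 y)"
  | "frame Fix_Second g c (x, y) = (fst (weights g c) *\<^sub>R vec2 (cnj y), snd (weights g c) *\<^sub>R vec2 x)"

lemma weights_nonzero: "c \<noteq> 0 \<Longrightarrow> fst (weights g c) \<noteq> 0 \<and> snd (weights g c) \<noteq> 0"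
  by (cases g) auto

lemma linear_frame: "linear (frame \<rho> g c)"
  by (cases \<rho>; rule linearI)
    (auto simp: linear_add[OF linear_vec2] linear_scale[OF linear_vec2] algebra_simps)

lemma inj_frame: "c \<noteq> 0 \<Longrightarrow> inj (frame \<rho> g c)"
  using weights_nonzero[of c g] by (cases \<rho>) (auto simp: inj_def vec2_eq_iff)

lemma grid_pt_weights:
  "grid_pt g n a b c i j = pt (fst (weights g c) *\<^sub>R u (real i * angle n a - real j * angle n b),
     snd (weights g c) *\<^sub>R u (real i * angle n a + real j * angle n b))"
  by (cases g) auto

lemma grid_pt_frame_first:
  "grid_pt g n a b c i j = pt (frame Fix_First g c
     (cis (real i * angle n a) * cnj (cis (real j * angle n b)),
      cis (real i * angle n a) * cis (real j * angle n b)))"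
  by (simp add: grid_pt_weights u_eq_vec2 cis_cnj cis_mult)

text \<open>With y = cis (j \<beta> - i \<alpha>), conjugation in the frame restores the angle i
  \<alpha> - j \<beta>, while x has the angle i \<alpha> + j \<beta>.\<close>

lemma grid_pt_frame_second:
  "grid_pt g n a b c i j = pt (frame Fix_Second g c
     (cis (real j * angle n b) * cnj (cis (real i * angle n (- a))),
      cis (real j * angle n b) * cis (real i * angle n (- a))))"
  by (simp add: grid_pt_weights u_eq_vec2 cis_cnj cis_mult angle_def algebra_simps)

lemma Collect_lessThan_image2:
  fixes n :: nat
  shows "{f (p i) (q j) | i j. i < n \<and> j < n} = {f x y | x y. x \<in> p ` {..<n} \<and> y \<in> q ` {..<n}}"
    and "{f (p j) (q i) | i j. i < n \<and> j < n} = {f x y | x y. x \<in> p ` {..<n} \<and> y \<in> q ` {..<n}}"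
  by blast+

context
  fixes n :: nat and a b :: int and c :: real and g :: grid_kind and \<rho> :: ruling
  assumes n: "n \<ge> 3" "odd n" and ab: "coprime a (int n)" "coprime b (int n)" and c: "c \<noteq> 0"
begin

interpretation complex_grid "frame \<rho> g c" n
  using n linear_frame inj_frame[OF c] by (rule complex_grid.intro[rotated 2])

text \<open>The roots of unity span the complex numbers over the reals, so the n grid points on a
  line already span its whole plane.\<close>

lemma proj_join_emb: "proj_join ((\<lambda>z. pt (emb \<omega> z)) ` unity_roots n) = grid_line \<omega>"
proof -
  have "proj_join (pt ` emb \<omega> ` unity_roots n) = proj (emb \<omega> ` span (unity_roots n))"
    unfolding proj_join_pt_image linear_span_image[OF linear_emb] ..
  then show ?thesis by (simp add: span_unity_roots n grid_line_def image_image)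
qed

lemma grid_eq_grid_pts: "grid g n a b c = grid_pts"
  and ruling_lines_eq: "ruling_lines \<rho> g n a b c = grid_line ` unity_roots n"
proof -
  define \<Omega> where "\<Omega> = unity_roots n"
  have \<Omega>: "\<Omega> = (\<lambda>k. cis (real k * angle n d)) ` {..<n}" if "coprime d (int n)" for d
    using cis_angle_multiples[of n d] that n by (simp add: \<Omega>_def)
  have "grid g n a b c = grid_pts \<and> ruling_lines \<rho> g n a b c = grid_line ` \<Omega>"
  proof (cases \<rho>)
    case Fix_First
    have e: "grid_pt g n a b c i j = pt (emb (cis (real i * angle n a)) (cis (real j * angle n b)))" for i j
      unfolding Fix_First emb_def[unfolded Fix_First] by (rule grid_pt_frame_first)
    have "grid g n a b c = grid_pts"
      unfolding grid_def grid_pts_def \<Omega>_def[symmetric] e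
      using Collect_lessThan_image2(1)[of "\<lambda>x y. pt (emb x y)" "\<lambda>k. cis (real k * angle n a)"
          "\<lambda>k. cis (real k * angle n b)" n]
      unfolding \<Omega>[OF ab(1), symmetric] \<Omega>[OF ab(2), symmetric] .
    moreover have "ruling_line \<rho> g n a b c k = grid_line (cis (real k * angle n a))" for k
    proof -
      have "{grid_pt g n a b c k j | j. j < n} = (\<lambda>z. pt (emb (cis (real k * angle n a)) z)) ` \<Omega>"
        unfolding e \<Omega>[OF ab(2)] by auto
      then show ?thesis using proj_join_emb by (simp add: Fix_First \<Omega>_def)
    qed
    ultimately show ?thesis
      unfolding ruling_lines_def \<Omega>[OF ab(1)] by auto
  next
    case Fix_Second
    \<comment> \<open>The first index now enters through \<open>- a\<close>, again a unit modulo n,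
      so the parameter \<open>z\<close> still runs through all roots of unity.\<close>
    have ma: "coprime (- a) (int n)" using ab(1) by simp
    have e: "grid_pt g n a b c i j = pt (emb (cis (real j * angle n b)) (cis (real i * angle n (- a))))" for i j
      unfolding Fix_Second emb_def[unfolded Fix_Second] by (rule grid_pt_frame_second)
    have "grid g n a b c = grid_pts"
      unfolding grid_def grid_pts_def \<Omega>_def[symmetric] e
      using Collect_lessThan_image2(2)[of "\<lambda>x y. pt (emb x y)" "\<lambda>k. cis (real k * angle n b)"
          "\<lambda>k. cis (real k * angle n (- a))" n]
      unfolding \<Omega>[OF ma, symmetric] \<Omega>[OF ab(2), symmetric] .
    moreover have "ruling_line \<rho> g n a b c k = grid_line (cis (real k * angle n b))" for k
    proof -
      have "{grid_pt g n a b c i k | i. i < n} = (\<lambda>z. pt (emb (cis (real k * angle n b)) z)) ` \<Omega>"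
        unfolding e \<Omega>[OF ma] by auto
      then show ?thesis using proj_join_emb by (simp add: Fix_Second \<Omega>_def)
    qed
    ultimately show ?thesis
      unfolding ruling_lines_def \<Omega>[OF ab(2)] by auto
  qed
  then show "grid g n a b c = grid_pts" "ruling_lines \<rho> g n a b c = grid_line ` unity_roots n"
    by (auto simp: \<Omega>_def)
qed

text \<open>Nonzero weights do not change the range of \<open>vec2\<close>. The second ruling's
  frame puts \<open>x\<close> into the other block, which turns the axis into
  \<open>L_minus\<close>.\<close>

lemma spectral_line_eq: "spectral_line \<rho> = axis_line"
proof -
  have v: "range (\<lambda>x. t *\<^sub>R vec2 x) = UNIV" if "t \<noteq> 0" for t :: real
  proof -
    have "y = t *\<^sub>R vec2 (inv vec2 ((1 / t) *\<^sub>R y))" for y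
      using that by (simp add: surj_f_inv_f[OF surj_vec2])
    then show ?thesis by blast
  qed
  have axis: "axis = (\<lambda>x. frame \<rho> g c (x, 0))" by (rule ext) (rule axis_def)
  have "range (\<lambda>x. (f x, 0::real^2)) = range f \<times> {0}" "range (\<lambda>x. (0::real^2, f x)) = {0} \<times> range f"
    for f :: "complex \<Rightarrow> real^2" by auto
  then have "range axis = (case \<rho> of Fix_First \<Rightarrow> UNIV \<times> {0} | Fix_Second \<Rightarrow> {0} \<times> UNIV)"
    unfolding axis using v weights_nonzero[OF c, of g] linear_0[OF linear_vec2]
    by (cases \<rho>) simp_all
  then show ?thesis
    unfolding axis_line_def by (cases \<rho>) (simp_all add: L_plus_def L_minus_def)
qed

lemma X_star_eq: "X_star \<rho> n = orbit"
proof -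
  have \<Omega>: "unity_roots n = (\<lambda>r. cis (2 * pi * real r / real n)) ` {..<n}"
    using cis_angle_multiples[of n 1] n by (simp add: angle_def mult.commute)
  have axis: "pt (axis (\<i> * cis \<theta>)) = (case \<rho> of Fix_First \<Rightarrow> pt (u (pi / 2 + \<theta>), 0)
      | Fix_Second \<Rightarrow> pt (0, u (pi / 2 + \<theta>)))" for \<theta>
  proof -
    \<comment> \<open>The factor \<open>\<i>\<close> is the offset pi/2 of the orbit, and the weight
      disappears projectively. Hence the orbit is independent of \<open>c\<close>.\<close>
    have "\<i> * cis \<theta> = cis (pi / 2 + \<theta>)" by (simp only: cis_mult flip: cis_pi_half)
    moreover have "pt (t *\<^sub>R x, 0::real^2) = pt (x, 0)" "pt (0::real^2, t *\<^sub>R x) = pt (0, x)"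
      if "t \<noteq> 0" for t :: real and x :: "real^2"
      using pt_scaleR[OF that, of "(x, 0::real^2)"] pt_scaleR[OF that, of "(0::real^2, x)"] by simp_all
    ultimately show ?thesis
      unfolding axis_def using weights_nonzero[OF c, of g] linear_0[OF linear_vec2]
      by (cases \<rho>) (simp_all add: u_eq_vec2)
  qed
  show ?thesis
    unfolding orbit_def \<Omega> image_image axis
    by (cases \<rho>) (auto simp: X_plus_def X_minus_def)
qed

lemma smallest_completion_X_star:
  "smallest_completion (grid g n a b c) (ruling_lines \<rho> g n a b c \<union> {spectral_line \<rho>}) X
    \<longleftrightarrow> X = X_star \<rho> n"
  using smallest_completion_iff
  by (simp add: grid_eq_grid_pts ruling_lines_eq spectral_line_eq X_star_eq members_def)

lemma X_star_subset_spectral_line: "X_star \<rho> n \<subseteq> spectral_line \<rho>"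
  using orbit_subset_axis_line by (simp add: spectral_line_eq X_star_eq)

lemma card_X_star: "card (X_star \<rho> n) = n"
  using card_orbit by (simp add: X_star_eq)

end

theorem theorem6p2:
  fixes n :: nat and a b :: int and c :: real and g :: grid_kind and \<rho> :: ruling
  assumes "n \<ge> 3" and "odd n"
    and "coprime a (int n)" and "coprime b (int n)"
    and "admissible n a b"
    and "c > 0" and "c\<^sup>2 = c_squared n a b"
  shows "X_star \<rho> n \<subseteq> spectral_line \<rho> \<and>
    (\<forall>X. smallest_completion (grid g n a b c)
            (ruling_lines \<rho> g n a b c \<union> {spectral_line \<rho>}) X \<longleftrightarrow> X = X_star \<rho> n) \<and>
    card (X_star \<rho> n) = n \<and>
    (\<forall>c'. c' > 0 \<and> c' \<noteq> 1 \<longrightarrow>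
       (\<forall>X. smallest_completion (grid g n a b c')
              (ruling_lines \<rho> g n a b c' \<union> {spectral_line \<rho>}) X \<longleftrightarrow> X = X_star \<rho> n))"
  \<comment> \<open>The first fact leaves the parameter open and so serves both \<open>c\<close> and
    every \<open>c'\<close>. The statements of the other two do not contain \<open>c\<close>, so it
    is instantiated explicitly.\<close>
  using assms smallest_completion_X_star[OF assms(1-4)] X_star_subset_spectral_line[where c = c, OF assms(1-4)]
    card_X_star[where c = c, OF assms(1-4)]
  by simp

end
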